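(* There exist an invertible positive selfadjoint linear operator $A$ on a Hilbert space $H$ and a unitary $v\in B(H)$ such that $A^{-1}vA$ is densely defined and bounded, but $\mathrm{Dom}(A^{-1}vA)$ is not a core for $A$.
   Context: "Invertible" for a positive selfadjoint (possibly unbounded) operator means injective, so $A^{-1}$ is a positive selfadjoint, possibly unbounded, operator. $\mathrm{Dom}(A^{-1}vA)=\{\xi\in\mathrm{Dom}(A): vA\xi\in\mathrm{Dom}(A^{-1})\}$ is the natural domain; "bounded" means bounded on this domain. *)

theory Defs
  imports "HOL-Analysis.Analysis" "HOL-Algebra.Module" "HOL-Algebra.Algebraic_Closure_Type"
begin

text \<open>
  Hilbert spaces are complex and carrier based, so that they can be quantified over inside a
  formula. The fields \<open>mult\<close> and \<open>one\<close> inherited from the module record are not used.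
\<close>

record 'a inner_product_module = "(complex, 'a) module" +
  cinner :: "'a \<Rightarrow> 'a \<Rightarrow> complex"

definition hnorm :: "('a, 'm) inner_product_module_scheme \<Rightarrow> 'a \<Rightarrow> real"
  where "hnorm H x = sqrt (Re (cinner H x x))"

text \<open>
  The library's metric spaces require a distance that is symmetric and nonnegative on the whole
  type, hence the totalisation outside the carrier.
\<close>

definition hdist :: "('a, 'm) inner_product_module_scheme \<Rightarrow> 'a \<Rightarrow> 'a \<Rightarrow> real"
  where "hdist H x y =
    (if x \<in> carrier H \<and> y \<in> carrier H then hnorm H (x \<ominus>\<^bsub>H\<^esub> y) else 0)"

locale pre_hilbert_space =
  module "ring_of_type_algebra :: complex ring" H
  for H :: "('a, 'm) inner_product_module_scheme" (structure) +
  assumes cinner_add_left: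
      "\<lbrakk>x \<in> carrier H; y \<in> carrier H; z \<in> carrier H\<rbrakk> \<Longrightarrow>
        cinner H (x \<oplus> y) z = cinner H x z + cinner H y z"
    and cinner_smult_left:
      "\<lbrakk>x \<in> carrier H; y \<in> carrier H\<rbrakk> \<Longrightarrow> cinner H (c \<odot> x) y = c * cinner H x y"
    and cinner_commute:
      "\<lbrakk>x \<in> carrier H; y \<in> carrier H\<rbrakk> \<Longrightarrow> cinner H x y = cnj (cinner H y x)"
    and cinner_nonneg: "x \<in> carrier H \<Longrightarrow> cinner H x x \<in> \<real>\<^sub>\<ge>\<^sub>0"
    and cinner_definite: "\<lbrakk>x \<in> carrier H; cinner H x x = 0\<rbrakk> \<Longrightarrow> x = \<zero>"
begin

lemma cinner_zero_left: "y \<in> carrier H \<Longrightarrow> cinner H \<zero> y = 0"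
  using cinner_add_left[of \<zero> \<zero> y] by simp

lemma cinner_minus_left:
  assumes "x \<in> carrier H" "y \<in> carrier H"
  shows "cinner H (\<ominus> x) y = - cinner H x y"
  using cinner_add_left[of x "\<ominus> x" y] cinner_zero_left[of y] assms
  by (simp add: M.r_neg minus_unique add_eq_0_iff)

lemma cinner_add_right:
  assumes "x \<in> carrier H" "y \<in> carrier H" "z \<in> carrier H"
  shows "cinner H z (x \<oplus> y) = cinner H z x + cinner H z y"
  using assms cinner_commute[of z "x \<oplus> y"] cinner_commute[of x z] cinner_commute[of y z]
  by (simp add: cinner_add_left)

lemma cinner_minus_right:
  assumes "x \<in> carrier H" "y \<in> carrier H"
  shows "cinner H y (\<ominus> x) = - cinner H y x"
  using assms cinner_commute[of y "\<ominus> x"] cinner_commute[of x y]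
  by (simp add: cinner_minus_left)

lemma smult_in_carrier: "x \<in> carrier H \<Longrightarrow> c \<odot> x \<in> carrier H"
  by (rule smult_closed) (simp_all add: ring_of_type_algebra_def)

lemma cinner_smult_right:
  assumes "x \<in> carrier H" "y \<in> carrier H"
  shows "cinner H y (c \<odot> x) = cnj c * cinner H y x"
  using assms cinner_commute[of y "c \<odot> x"] cinner_commute[of x y]
  by (simp add: cinner_smult_left smult_in_carrier)

lemma cinner_self: "x \<in> carrier H \<Longrightarrow> cinner H x x = of_real ((hnorm H x)\<^sup>2)"
  using cinner_nonneg[of x] by (auto simp: hnorm_def nonneg_Reals_def simp flip: of_real_power)

lemma hnorm_ge_zero: "x \<in> carrier H \<Longrightarrow> 0 \<le> hnorm H x"
  using cinner_nonneg[of x] by (auto simp: hnorm_def nonneg_Reals_def)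

lemma hnorm_eq_zero: "x \<in> carrier H \<Longrightarrow> hnorm H x = 0 \<longleftrightarrow> x = \<zero>"
  using cinner_self[of x] cinner_definite[of x] cinner_zero_left[of \<zero>] by auto

lemma Re_cinner_le:
  assumes x: "x \<in> carrier H" and y: "y \<in> carrier H"
  shows "Re (cinner H x y) \<le> hnorm H x * hnorm H y"
proof (cases "hnorm H x = 0 \<or> hnorm H y = 0")
  case True
  then have "cinner H x y = 0"
    using x y hnorm_eq_zero cinner_zero_left cinner_commute[OF x y] by auto
  then show ?thesis using x y by (simp add: hnorm_ge_zero)
next
  case False
  define a b where "a = hnorm H x" and "b = hnorm H y"
  have ab: "0 < a" "0 < b"
    using False x y hnorm_ge_zero by (auto simp: a_def b_def less_le)
  define u where "u = complex_of_real b \<odot> x"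
  define w where "w = complex_of_real (- a) \<odot> y"
  have uw: "u \<in> carrier H" "w \<in> carrier H"
    using x y by (simp_all add: u_def w_def smult_in_carrier)
  have sym: "Re (cinner H y x) = Re (cinner H x y)"
    using cinner_commute[OF x y] by simp
  have "cinner H (u \<oplus> w) (u \<oplus> w)
      = cinner H u u + cinner H u w + cinner H w u + cinner H w w"
    using uw by (simp add: cinner_add_left cinner_add_right)
  then have "Re (cinner H (u \<oplus> w) (u \<oplus> w))
      = Re (cinner H u u) + Re (cinner H u w) + Re (cinner H w u) + Re (cinner H w w)"
    by simp
  also have "\<dots> = 2 * (a * b) * (a * b - Re (cinner H x y))"
    using x y cinner_self[OF x] cinner_self[OF y] sym
    by (simp add: u_def w_def cinner_smult_left cinner_smult_right smult_in_carrier
        algebra_simps power2_eq_square flip: a_def b_def)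
  finally have "Re (cinner H (u \<oplus> w) (u \<oplus> w))
      = 2 * (a * b) * (a * b - Re (cinner H x y))" .
  moreover have "0 \<le> Re (cinner H (u \<oplus> w) (u \<oplus> w))"
    using cinner_nonneg[of "u \<oplus> w"] uw by (auto simp: nonneg_Reals_def)
  ultimately show ?thesis
    using mult_pos_pos[OF ab] by (auto simp: zero_le_mult_iff simp flip: a_def b_def)
qed

lemma hnorm_add_le:
  assumes x: "x \<in> carrier H" and y: "y \<in> carrier H"
  shows "hnorm H (x \<oplus> y) \<le> hnorm H x + hnorm H y"
proof (rule power2_le_imp_le)
  have "Re (cinner H y x) = Re (cinner H x y)"
    using cinner_commute[OF x y] by simp
  then have "Re (cinner H (x \<oplus> y) (x \<oplus> y))
      = (hnorm H x)\<^sup>2 + (hnorm H y)\<^sup>2 + 2 * Re (cinner H x y)"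
    using x y cinner_self[OF x] cinner_self[OF y] by (simp add: cinner_add_left cinner_add_right)
  then show "(hnorm H (x \<oplus> y))\<^sup>2 \<le> (hnorm H x + hnorm H y)\<^sup>2"
    using Re_cinner_le[OF x y] x y cinner_self[of "x \<oplus> y"] by (simp add: power2_sum)
  show "0 \<le> hnorm H x + hnorm H y"
    using x y by (simp add: hnorm_ge_zero)
qed

sublocale Metric_space "carrier H" "hdist H"
proof
  have neg: "hnorm H (\<ominus> x) = hnorm H x" if "x \<in> carrier H" for x
    using that by (simp add: hnorm_def cinner_minus_left cinner_minus_right)
  show "0 \<le> hdist H x y" for x y
    by (simp add: hdist_def hnorm_ge_zero)
  show "hdist H x y = hdist H y x" for x y
    using neg[of "x \<ominus> y"]
    by (auto simp: hdist_def M.minus_eq M.minus_add M.a_comm)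
  show "hdist H x y = 0 \<longleftrightarrow> x = y" if "x \<in> carrier H" "y \<in> carrier H" for x y
  proof -
    have "x = (x \<ominus> y) \<oplus> y"
      using that by (simp add: M.minus_eq M.a_assoc M.l_neg)
    then have "x \<ominus> y = \<zero> \<longleftrightarrow> x = y"
      using that by (metis M.l_zero M.minus_eq M.r_neg)
    then show ?thesis
      using that by (simp add: hdist_def hnorm_eq_zero)
  qed
  show "hdist H x z \<le> hdist H x y + hdist H y z"
    if "x \<in> carrier H" "y \<in> carrier H" "z \<in> carrier H" for x y z
  proof -
    have "x \<ominus> z = (x \<ominus> y) \<oplus> (y \<ominus> z)"
      using that by (simp add: M.minus_eq M.a_assoc M.r_neg1)
    then show ?thesis
      using that hnorm_add_le[of "x \<ominus> y" "y \<ominus> z"] by (simp add: hdist_def)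
  qed
qed

end

locale hilbert_space = pre_hilbert_space +
  assumes complete: mcomplete

abbreviation htopology :: "('a, 'm) inner_product_module_scheme \<Rightarrow> 'a topology"
  where "htopology H \<equiv> Metric_space.mtopology (carrier H) (hdist H)"

text \<open>
  A (possibly unbounded) operator is a partial map \<open>T\<close> with domain \<open>dom T\<close>. Equality of partial
  maps includes equality of domains, and \<open>S \<circ>\<^sub>m T\<close> has the natural domain
  \<open>{x \<in> dom T. the (T x) \<in> dom S}\<close>.
\<close>

definition linear_operator ::
    "('a, 'm) inner_product_module_scheme \<Rightarrow> ('a \<rightharpoonup> 'a) \<Rightarrow> bool"
  where "linear_operator H T \<longleftrightarrow>
    submodule (dom T) (ring_of_type_algebra :: complex ring) H \<and>
    ran T \<subseteq> carrier H \<and>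
    (\<forall>x\<in>dom T. \<forall>y\<in>dom T. the (T (x \<oplus>\<^bsub>H\<^esub> y)) = the (T x) \<oplus>\<^bsub>H\<^esub> the (T y)) \<and>
    (\<forall>c. \<forall>x\<in>dom T. the (T (c \<odot>\<^bsub>H\<^esub> x)) = c \<odot>\<^bsub>H\<^esub> the (T x))"

definition densely_defined ::
    "('a, 'm) inner_product_module_scheme \<Rightarrow> ('a \<rightharpoonup> 'a) \<Rightarrow> bool"
  where "densely_defined H T \<longleftrightarrow> htopology H closure_of dom T = carrier H"

definition bounded_operator ::
    "('a, 'm) inner_product_module_scheme \<Rightarrow> ('a \<rightharpoonup> 'a) \<Rightarrow> bool"
  where "bounded_operator H T \<longleftrightarrow>
    (\<exists>C. \<forall>x\<in>dom T. hnorm H (the (T x)) \<le> C * hnorm H x)"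

definition id_operator :: "('a, 'm) inner_product_module_scheme \<Rightarrow> ('a \<rightharpoonup> 'a)"
  where "id_operator H = Some |` carrier H"

text \<open>The description below is unique only for densely defined \<open>T\<close>.\<close>

definition adjoint_operator ::
    "('a, 'm) inner_product_module_scheme \<Rightarrow> ('a \<rightharpoonup> 'a) \<Rightarrow> ('a \<rightharpoonup> 'a)"
  where "adjoint_operator H T = (\<lambda>y.
    let is_image = (\<lambda>z. z \<in> carrier H \<and>
      (\<forall>x\<in>dom T. cinner H (the (T x)) y = cinner H x z))
    in if y \<in> carrier H \<and> (\<exists>z. is_image z) then Some (THE z. is_image z) else None)"

definition selfadjoint_operator ::
    "('a, 'm) inner_product_module_scheme \<Rightarrow> ('a \<rightharpoonup> 'a) \<Rightarrow> bool"
  where "selfadjoint_operator H T \<longleftrightarrow>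
    linear_operator H T \<and> densely_defined H T \<and> adjoint_operator H T = T"

definition positive_operator ::
    "('a, 'm) inner_product_module_scheme \<Rightarrow> ('a \<rightharpoonup> 'a) \<Rightarrow> bool"
  where "positive_operator H T \<longleftrightarrow> (\<forall>x\<in>dom T. cinner H (the (T x)) x \<in> \<real>\<^sub>\<ge>\<^sub>0)"

definition unitary_operator ::
    "('a, 'm) inner_product_module_scheme \<Rightarrow> ('a \<rightharpoonup> 'a) \<Rightarrow> bool"
  where "unitary_operator H v \<longleftrightarrow>
    linear_operator H v \<and> dom v = carrier H \<and> bounded_operator H v \<and>
    adjoint_operator H v \<circ>\<^sub>m v = id_operator H \<and>
    v \<circ>\<^sub>m adjoint_operator H v = id_operator H"

definition inverse_operator :: "('a \<rightharpoonup> 'a) \<Rightarrow> ('a \<rightharpoonup> 'a)"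
  where "inverse_operator T =
    (\<lambda>y. if y \<in> ran T then Some (THE x. T x = Some y) else None)"

text \<open>\<open>D\<close> is a core for \<open>T\<close> if \<open>T\<close> is the closure of its restriction to \<open>D\<close>.\<close>

definition is_core ::
    "('a, 'm) inner_product_module_scheme \<Rightarrow> 'a set \<Rightarrow> ('a \<rightharpoonup> 'a) \<Rightarrow> bool"
  where "is_core H D T \<longleftrightarrow> D \<subseteq> dom T \<and>
    prod_topology (htopology H) (htopology H) closure_of Map.graph (T |` D) = Map.graph T"

end

theory Submission
  imports Defs
begin

text \<open>
  The example is a positive diagonal operator \<open>A\<close> on \<open>\<ell>\<^sup>2\<close>, conjugating a reflection
  \<open>v x = x - 2 \<langle>x, u\<rangle> u\<close> in a unit vector \<open>u\<close> that lies neither in the domain nor in the range of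
  \<open>A\<close>.

  For \<open>x\<close> in the domain of \<open>A\<close>, the vector \<open>v A x = A x - 2 \<langle>A x, u\<rangle> u\<close> differs from an element of the
  range of \<open>A\<close> by a multiple of \<open>u\<close>. Since \<open>u\<close> is not in the range, \<open>v A x\<close> is in the range exactly when
  \<open>\<langle>A x, u\<rangle> = 0\<close>, and then \<open>v A x = A x\<close>. So \<open>A\<^sup>-\<^sup>1 v A\<close> is the identity of
  \<open>D = {x \<in> Dom A. \<langle>A x, u\<rangle> = 0}\<close>, which makes it trivially bounded (\<open>conjugated_reflection\<close>).

  The two topologies on \<open>Dom A\<close> disagree about \<open>D\<close>. Since \<open>u\<close> is not in the domain of \<open>A = A\<^sup>*\<close>, the
  functional \<open>x \<mapsto> \<langle>A x, u\<rangle>\<close> is discontinuous in the norm of \<open>\<ell>\<^sup>2\<close>, so its kernel \<open>D\<close> is dense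
  (\<open>dense_kernel\<close>). In the graph norm of \<open>A\<close> it is continuous and not zero, so \<open>D\<close> is a closed
  proper subspace, hence not a core (\<open>kernel_not_core\<close>).

  Such a \<open>u\<close> exists only if both \<open>A\<close> and \<open>A\<^sup>-\<^sup>1\<close> are unbounded. The weights are therefore \<open>4\<^sup>n\<close> for
  even \<open>n\<close> and \<open>4\<^sup>-\<^sup>n\<close> for odd \<open>n\<close>, and the coordinates of \<open>u\<close> are proportional to \<open>2\<^sup>-\<^sup>n\<close>:
  square summable, but growing like \<open>2\<^sup>n\<close> along the even indices after applying \<open>A\<close>, and along the
  odd indices after applying \<open>A\<^sup>-\<^sup>1\<close>.
\<close>

section \<open>The Cauchy-Schwarz inequality\<close>

lemma (in pre_hilbert_space) cmod_cinner_le: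
  assumes x: "x \<in> carrier H" and y: "y \<in> carrier H"
  shows "cmod (cinner H x y) \<le> hnorm H x * hnorm H y"
proof (cases "cinner H x y = 0")
  case True
  then show ?thesis using x y by (simp add: hnorm_ge_zero)
next
  case False
  \<comment> \<open>Rotating \<open>y\<close> by the phase \<open>c\<close> of the inner product makes the inner product real and nonnegative,
    so the bound on its real part suffices.\<close>
  define z where "z = cinner H x y"
  define c where "c = z / of_real (cmod z)"
  have z: "of_real (cmod z) \<noteq> (0 :: complex)" "z * cnj z = (of_real (cmod z))\<^sup>2"
    using False by (simp_all add: z_def complex_norm_square[symmetric])
  have c: "c * cnj c = 1"
    using z by (simp add: c_def power2_eq_square)
  have "cinner H x (c \<odot> y) = of_real (cmod z)"
    using x y z by (simp add: c_def cinner_smult_right power2_eq_square mult.commute flip: z_def)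
  moreover have "hnorm H (c \<odot> y) = hnorm H y"
  proof -
    have "cinner H (c \<odot> y) (c \<odot> y) = (c * cnj c) * cinner H y y"
      using y by (simp add: cinner_smult_left cinner_smult_right smult_in_carrier)
    then show ?thesis by (simp add: hnorm_def c)
  qed
  ultimately show ?thesis
    using Re_cinner_le[OF x smult_in_carrier[OF y, of c]] by (simp add: z_def)
qed

section \<open>The Hilbert space of square summable sequences\<close>

definition l2 :: "(nat \<Rightarrow> complex) inner_product_module" where
  "l2 = \<lparr>carrier = {x. summable (\<lambda>n. (cmod (x n))\<^sup>2)},
     monoid.mult = (\<lambda>x y n. x n * y n), one = (\<lambda>n. 1),
     ring.zero = (\<lambda>n. 0), add = (\<lambda>x y n. x n + y n),
     smult = (\<lambda>c x n. c * x n),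
     cinner = (\<lambda>x y. \<Sum>n. x n * cnj (y n))\<rparr>"

lemma l2_simps [simp]:
  "x \<in> carrier l2 \<longleftrightarrow> summable (\<lambda>n. (cmod (x n))\<^sup>2)"
  "\<zero>\<^bsub>l2\<^esub> = (\<lambda>n. 0)"
  "x \<oplus>\<^bsub>l2\<^esub> y = (\<lambda>n. x n + y n)"
  "c \<odot>\<^bsub>l2\<^esub> x = (\<lambda>n. c * x n)"
  by (simp_all add: l2_def)

lemma cinner_l2: "cinner l2 x y = (\<Sum>n. x n * cnj (y n))"
  by (simp add: l2_def)

lemma summable_cinner_l2:
  assumes "x \<in> carrier l2" "y \<in> carrier l2"
  shows "summable (\<lambda>n. x n * cnj (y n))"
proof (rule summable_comparison_test')
  show "summable (\<lambda>n. (cmod (x n))\<^sup>2 + (cmod (y n))\<^sup>2)"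
    using assms by (intro summable_add) simp_all
  show "norm (x n * cnj (y n)) \<le> (cmod (x n))\<^sup>2 + (cmod (y n))\<^sup>2" for n
    using sum_squares_bound[of "cmod (x n)" "cmod (y n)"]
      mult_nonneg_nonneg[OF norm_ge_zero[of "x n"] norm_ge_zero[of "y n"]]
    unfolding norm_mult complex_mod_cnj by linarith
qed

lemma l2_add_closed:
  assumes "x \<in> carrier l2" "y \<in> carrier l2"
  shows "(\<lambda>n. x n + y n) \<in> carrier l2"
proof -
  have "summable (\<lambda>n. (cmod (x n + y n))\<^sup>2)"
  proof (rule summable_comparison_test')
    show "summable (\<lambda>n. 2 * (cmod (x n))\<^sup>2 + 2 * (cmod (y n))\<^sup>2)"
      using assms by (intro summable_add summable_mult) simp_all
    show "norm ((cmod (x n + y n))\<^sup>2) \<le> 2 * (cmod (x n))\<^sup>2 + 2 * (cmod (y n))\<^sup>2" for n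
    proof -
      have "(cmod (x n + y n))\<^sup>2 \<le> (cmod (x n) + cmod (y n))\<^sup>2"
        by (intro power_mono norm_triangle_ineq) simp
      then show ?thesis
        using sum_squares_bound[of "cmod (x n)" "cmod (y n)"] by (simp add: power2_sum)
    qed
  qed
  then show ?thesis by simp
qed

lemma l2_smult_closed:
  assumes "x \<in> carrier l2"
  shows "(\<lambda>n. c * x n) \<in> carrier l2"
  using assms by (simp add: norm_mult power_mult_distrib summable_mult)

lemma l2_diff_closed:
  assumes "x \<in> carrier l2" "y \<in> carrier l2"
  shows "(\<lambda>n. x n - y n) \<in> carrier l2"
  using l2_add_closed[OF assms(1) l2_smult_closed[OF assms(2), of "-1"]] by simp

lemma finite_support_in_l2:
  assumes "\<And>n. n \<ge> N \<Longrightarrow> x n = 0"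
  shows "x \<in> carrier l2"
  unfolding l2_simps by (rule summable_finite[of "{..<N}"]) (simp_all add: assms)

lemma cinner_l2_self:
  assumes "x \<in> carrier l2"
  shows "cinner l2 x x = of_real (\<Sum>n. (cmod (x n))\<^sup>2)"
  using assms by (simp add: cinner_l2 complex_norm_square[symmetric] suminf_of_real)

lemma hnorm_l2:
  assumes "x \<in> carrier l2"
  shows "hnorm l2 x = sqrt (\<Sum>n. (cmod (x n))\<^sup>2)"
  by (simp only: hnorm_def cinner_l2_self[OF assms] Re_complex_of_real)

lemma abelian_group_l2: "abelian_group l2"
proof (rule abelian_groupI)
  show "\<exists>y\<in>carrier l2. y \<oplus>\<^bsub>l2\<^esub> x = \<zero>\<^bsub>l2\<^esub>" if "x \<in> carrier l2" for x
    using that by (intro bexI[of _ "\<lambda>n. - x n"]) simp_all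
  show "x \<oplus>\<^bsub>l2\<^esub> y \<in> carrier l2" if "x \<in> carrier l2" "y \<in> carrier l2" for x y
    using l2_add_closed[OF that] by simp
qed (simp_all add: algebra_simps)

lemma pre_hilbert_space_l2: "pre_hilbert_space l2"
proof (intro pre_hilbert_space.intro pre_hilbert_space_axioms.intro moduleI)
  show "cring (ring_of_type_algebra :: complex ring)"
    by (rule cring_from_type_algebra)
  show "abelian_group l2"
    by (rule abelian_group_l2)
  show "a \<odot>\<^bsub>l2\<^esub> x \<in> carrier l2" if "x \<in> carrier l2" for a x
    using l2_smult_closed[OF that] by simp
  show "cinner l2 (x \<oplus>\<^bsub>l2\<^esub> y) z = cinner l2 x z + cinner l2 y z"
    if "x \<in> carrier l2" "y \<in> carrier l2" "z \<in> carrier l2" for x y z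
    using suminf_add[OF summable_cinner_l2[of x z] summable_cinner_l2[of y z]] that
    by (simp add: cinner_l2 algebra_simps)
  show "cinner l2 (c \<odot>\<^bsub>l2\<^esub> x) y = c * cinner l2 x y"
    if "x \<in> carrier l2" "y \<in> carrier l2" for c x y
    using suminf_mult[OF summable_cinner_l2[of x y], of c] that
    by (simp add: cinner_l2 algebra_simps)
  show "cinner l2 x y = cnj (cinner l2 y x)"
    if "x \<in> carrier l2" "y \<in> carrier l2" for x y
    using sums_cnj[of "\<lambda>n. y n * cnj (x n)" "cinner l2 y x"] summable_sums[OF summable_cinner_l2[of y x]] that
    by (simp add: cinner_l2 sums_iff mult.commute)
  show "cinner l2 x x \<in> \<real>\<^sub>\<ge>\<^sub>0" if "x \<in> carrier l2" for x
    using that unfolding cinner_l2_self[OF that] by (simp add: suminf_nonneg)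
  show "x = \<zero>\<^bsub>l2\<^esub>" if "x \<in> carrier l2" "cinner l2 x x = 0" for x
  proof -
    have "(\<Sum>n. (cmod (x n))\<^sup>2) = 0"
      using that(2) unfolding cinner_l2_self[OF that(1)] by simp
    then have "\<forall>n. (cmod (x n))\<^sup>2 = 0"
      using that(1) by (subst (asm) suminf_eq_zero_iff) simp_all
    then show ?thesis by (simp add: fun_eq_iff)
  qed
qed (auto simp: ring_of_type_algebra_def algebra_simps)

interpretation l2: pre_hilbert_space l2
  by (rule pre_hilbert_space_l2)

lemma l2_minus:
  assumes "x \<in> carrier l2" "y \<in> carrier l2"
  shows "x \<ominus>\<^bsub>l2\<^esub> y = (\<lambda>n. x n - y n)"
proof -
  have "\<ominus>\<^bsub>l2\<^esub> y = (\<lambda>n. - y n)"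
    using assms by (intro l2.M.minus_equality) simp_all
  then show ?thesis by (simp add: l2.M.minus_eq)
qed

lemma hdist_l2:
  assumes "x \<in> carrier l2" "y \<in> carrier l2"
  shows "hdist l2 x y = sqrt (\<Sum>n. (cmod (x n - y n))\<^sup>2)"
  using assms hnorm_l2[OF l2_diff_closed[OF assms]] l2_minus[OF assms] by (simp add: hdist_def)

lemma sum_le_hdist_l2:
  assumes "x \<in> carrier l2" "y \<in> carrier l2" "finite J"
  shows "(\<Sum>n\<in>J. (cmod (x n - y n))\<^sup>2) \<le> (hdist l2 x y)\<^sup>2"
  using l2_diff_closed[OF assms(1,2)] assms(3)
  by (simp add: hdist_l2[OF assms(1,2)] suminf_nonneg sum_le_suminf)

lemma cmod_le_hdist_l2:
  assumes "x \<in> carrier l2" "y \<in> carrier l2"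
  shows "cmod (x n - y n) \<le> hdist l2 x y"
proof (rule power2_le_imp_le)
  show "(cmod (x n - y n))\<^sup>2 \<le> (hdist l2 x y)\<^sup>2"
    using sum_le_hdist_l2[OF assms, of "{n}"] by simp
qed (rule l2.nonneg)

text \<open>
  A Cauchy sequence converges coordinatewise. The Cauchy estimate on finitely many coordinates
  survives this limit, with a bound independent of the number of coordinates, so the coordinatewise
  limit is a limit in norm.
\<close>

lemma hilbert_space_l2: "hilbert_space l2"
proof (intro hilbert_space.intro hilbert_space_axioms.intro pre_hilbert_space_l2)
  show "l2.mcomplete"
    unfolding l2.mcomplete_def
  proof (intro allI impI)
    fix \<sigma> assume "l2.MCauchy \<sigma>"
    then have mem: "\<And>k. \<sigma> k \<in> carrier l2"
      and cauchy: "\<And>e. e > 0 \<Longrightarrow> \<exists>N. \<forall>k m. N \<le> k \<longrightarrow> N \<le> m \<longrightarrow> hdist l2 (\<sigma> k) (\<sigma> m) < e"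
      unfolding l2.MCauchy_def by blast+
    have "Cauchy (\<lambda>k. \<sigma> k n)" for n
      unfolding Cauchy_def dist_norm
      using cauchy cmod_le_hdist_l2[OF mem mem] by (meson le_less_trans)
    then have "\<exists>l. (\<lambda>k. \<sigma> k n) \<longlonglongrightarrow> l" for n
      by (simp add: Cauchy_convergent_iff convergent_def)
    then obtain L where L: "\<And>n. (\<lambda>k. \<sigma> k n) \<longlonglongrightarrow> L n"
      by metis
    have tail: "\<exists>N. \<forall>k\<ge>N. (\<lambda>n. \<sigma> k n - L n) \<in> carrier l2 \<and>
        (\<Sum>n. (cmod (\<sigma> k n - L n))\<^sup>2) \<le> e\<^sup>2" if e: "e > 0" for e
    proof -
      obtain N where N: "\<And>k m. N \<le> k \<Longrightarrow> N \<le> m \<Longrightarrow> hdist l2 (\<sigma> k) (\<sigma> m) < e"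
        using cauchy[OF e] by blast
      have "(\<Sum>n\<in>J. (cmod (\<sigma> k n - L n))\<^sup>2) \<le> e\<^sup>2" if "k \<ge> N" "finite J" for k J
      proof (rule LIMSEQ_le_const2)
        show "(\<lambda>m. \<Sum>n\<in>J. (cmod (\<sigma> k n - \<sigma> m n))\<^sup>2) \<longlonglongrightarrow> (\<Sum>n\<in>J. (cmod (\<sigma> k n - L n))\<^sup>2)"
          by (intro tendsto_intros L)
        have "(\<Sum>n\<in>J. (cmod (\<sigma> k n - \<sigma> m n))\<^sup>2) \<le> e\<^sup>2" if "m \<ge> N" for m
        proof -
          have "(hdist l2 (\<sigma> k) (\<sigma> m))\<^sup>2 \<le> e\<^sup>2"
            using N[OF \<open>k \<ge> N\<close> that] by (intro power_mono) simp_all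
          then show ?thesis
            using sum_le_hdist_l2[OF mem mem \<open>finite J\<close>, of k m] by linarith
        qed
        then show "\<exists>M. \<forall>m\<ge>M. (\<Sum>n\<in>J. (cmod (\<sigma> k n - \<sigma> m n))\<^sup>2) \<le> e\<^sup>2"
          by blast
      qed
      then have bound: "(\<Sum>n<j. (cmod (\<sigma> k n - L n))\<^sup>2) \<le> e\<^sup>2" if "k \<ge> N" for k j
        using that by simp
      have "summable (\<lambda>n. (cmod (\<sigma> k n - L n))\<^sup>2)" if "k \<ge> N" for k
        using bound[OF that] by (intro summableI_nonneg_bounded[where x = "e\<^sup>2"]) simp_all
      then show ?thesis
        using bound by (intro exI[of _ N]) (auto intro: suminf_le_const)
    qed
    have L_mem: "L \<in> carrier l2"
    proof -
      obtain k where k: "(\<lambda>n. \<sigma> k n - L n) \<in> carrier l2"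
        using tail[of 1] by auto
      show ?thesis using l2_diff_closed[OF mem[of k] k] by simp
    qed
    have "\<exists>N. \<forall>k\<ge>N. hdist l2 (\<sigma> k) L < e" if e: "e > 0" for e
    proof -
      obtain N where N: "\<And>k. k \<ge> N \<Longrightarrow> (\<Sum>n. (cmod (\<sigma> k n - L n))\<^sup>2) \<le> (e / 2)\<^sup>2"
        using tail[of "e / 2"] e by auto
      have "hdist l2 (\<sigma> k) L < e" if "k \<ge> N" for k
        using real_sqrt_le_mono[OF N[OF that]] e by (simp add: hdist_l2[OF mem L_mem])
      then show ?thesis by blast
    qed
    then have "limitin l2.mtopology \<sigma> L sequentially"
      unfolding l2.limit_metric_sequentially using mem L_mem by blast
    then show "\<exists>x. limitin l2.mtopology \<sigma> x sequentially" by blast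
  qed
qed

lemma finite_support_dense_l2:
  assumes x: "x \<in> carrier l2" and r: "r > 0"
  obtains N where "hdist l2 x (\<lambda>n. if n < N then x n else 0) < r"
proof -
  obtain N where N: "norm (\<Sum>n. (cmod (x (n + N)))\<^sup>2) < r\<^sup>2"
    using suminf_exist_split[of "r\<^sup>2" "\<lambda>n. (cmod (x n))\<^sup>2"] x r by auto
  define z where "z = (\<lambda>n. if n < N then x n else 0)"
  have z: "z \<in> carrier l2"
    by (rule finite_support_in_l2[of N]) (simp add: z_def)
  have "(\<Sum>n. (cmod (x n - z n))\<^sup>2)
      = (\<Sum>n. (cmod (x (n + N) - z (n + N)))\<^sup>2) + (\<Sum>n<N. (cmod (x n - z n))\<^sup>2)"
    using l2_diff_closed[OF x z] by (intro suminf_split_initial_segment) simp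
  then have "(\<Sum>n. (cmod (x n - z n))\<^sup>2) < r\<^sup>2"
    using N by (simp add: z_def)
  then have "hdist l2 x z < r"
    using r real_sqrt_less_mono by (fastforce simp: hdist_l2[OF x z])
  then show ?thesis using that by (simp add: z_def)
qed

definition unit_sequence :: "nat \<Rightarrow> nat \<Rightarrow> complex" where
  "unit_sequence m = (\<lambda>n. if n = m then 1 else 0)"

lemma unit_sequence_in_l2: "unit_sequence m \<in> carrier l2"
  by (rule finite_support_in_l2[of "Suc m"]) (simp add: unit_sequence_def)

lemma suminf_single:
  fixes f :: "nat \<Rightarrow> complex"
  assumes "\<And>n. n \<noteq> m \<Longrightarrow> f n = 0"
  shows "suminf f = f m"
  using suminf_finite[of "{m}" f] assms by auto

section \<open>Diagonal operators\<close>

definition diagonal_operator :: "(nat \<Rightarrow> real) \<Rightarrow> ((nat \<Rightarrow> complex) \<rightharpoonup> (nat \<Rightarrow> complex))" where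
  "diagonal_operator a = (\<lambda>x. if x \<in> carrier l2 \<and> (\<lambda>n. of_real (a n) * x n) \<in> carrier l2
     then Some (\<lambda>n. of_real (a n) * x n) else None)"

lemma dom_diagonal:
  "dom (diagonal_operator a) = {x \<in> carrier l2. (\<lambda>n. of_real (a n) * x n) \<in> carrier l2}"
  by (auto simp: diagonal_operator_def dom_def simp del: l2_simps split: if_splits)

lemma diagonal_apply:
  "x \<in> dom (diagonal_operator a) \<Longrightarrow> diagonal_operator a x = Some (\<lambda>n. of_real (a n) * x n)"
  unfolding dom_diagonal by (simp add: diagonal_operator_def del: l2_simps)

lemma finite_support_in_dom_diagonal:
  assumes "\<And>n. n \<ge> N \<Longrightarrow> x n = 0"
  shows "x \<in> dom (diagonal_operator a)"
  unfolding dom_diagonal using assms by (auto intro!: finite_support_in_l2[of N] simp del: l2_simps)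

lemma unit_sequence_in_dom_diagonal: "unit_sequence m \<in> dom (diagonal_operator a)"
  by (rule finite_support_in_dom_diagonal[of "Suc m"]) (simp add: unit_sequence_def)

lemma linear_diagonal: "linear_operator l2 (diagonal_operator a)"
  unfolding linear_operator_def
proof (intro conjI ballI allI)
  have add: "x \<oplus>\<^bsub>l2\<^esub> y \<in> dom (diagonal_operator a)"
    if "x \<in> dom (diagonal_operator a)" "y \<in> dom (diagonal_operator a)" for x y
    using that l2_add_closed[of x y]
      l2_add_closed[of "\<lambda>n. of_real (a n) * x n" "\<lambda>n. of_real (a n) * y n"]
    unfolding dom_diagonal by (simp add: distrib_left)
  have smult: "c \<odot>\<^bsub>l2\<^esub> x \<in> dom (diagonal_operator a)"
    if "x \<in> dom (diagonal_operator a)" for c x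
    using that l2_smult_closed[of x c] l2_smult_closed[of "\<lambda>n. of_real (a n) * x n" c]
    unfolding dom_diagonal by (simp add: mult.left_commute)
  have neg: "\<ominus>\<^bsub>l2\<^esub> x \<in> dom (diagonal_operator a)" if "x \<in> dom (diagonal_operator a)" for x
  proof -
    have "x \<in> carrier l2" using that unfolding dom_diagonal by blast
    then have "\<ominus>\<^bsub>l2\<^esub> x = (-1) \<odot>\<^bsub>l2\<^esub> x"
      by (intro l2.M.minus_equality) simp_all
    then show ?thesis using smult[OF that, of "-1"] by simp
  qed
  show "submodule (dom (diagonal_operator a)) (ring_of_type_algebra :: complex ring) l2"
    by (rule l2.submoduleI) (use add smult neg in \<open>auto simp: dom_diagonal simp del: l2_simps(3,4)\<close>)
  show "ran (diagonal_operator a) \<subseteq> carrier l2"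
    by (auto simp: ran_def diagonal_operator_def split: if_splits)
  show "the (diagonal_operator a (x \<oplus>\<^bsub>l2\<^esub> y))
      = the (diagonal_operator a x) \<oplus>\<^bsub>l2\<^esub> the (diagonal_operator a y)"
    if "x \<in> dom (diagonal_operator a)" "y \<in> dom (diagonal_operator a)" for x y
    using diagonal_apply[OF add[OF that]] that by (simp add: diagonal_apply distrib_left)
  show "the (diagonal_operator a (c \<odot>\<^bsub>l2\<^esub> x)) = c \<odot>\<^bsub>l2\<^esub> the (diagonal_operator a x)"
    if "x \<in> dom (diagonal_operator a)" for c x
    using diagonal_apply[OF smult[OF that, of c]] that
    by (simp add: diagonal_apply mult.left_commute)
qed

text \<open>
  If \<open>z\<close> satisfies the defining equations of the adjoint at \<open>y\<close>, then testing them against the unit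
  sequences, which lie in the domain, gives \<open>z = a y\<close>. So \<open>a y\<close> is square summable, which puts \<open>y\<close> in
  the domain of the diagonal operator: the adjoint has no larger domain.
\<close>

lemma selfadjoint_diagonal: "selfadjoint_operator l2 (diagonal_operator a)"
  unfolding selfadjoint_operator_def
proof (intro conjI linear_diagonal)
  show "densely_defined l2 (diagonal_operator a)"
    unfolding densely_defined_def l2.metric_closure_of
  proof (intro equalityI subsetI CollectI conjI allI impI)
    fix x and r :: real assume x: "x \<in> carrier l2" and r: "r > 0"
    obtain N where N: "hdist l2 x (\<lambda>n. if n < N then x n else 0) < r" (is "hdist l2 x ?z < r")
      using finite_support_dense_l2[OF x r] .
    have z: "?z \<in> dom (diagonal_operator a)"
      by (rule finite_support_in_dom_diagonal[of N]) simp
    then have "?z \<in> carrier l2" unfolding dom_diagonal by blast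
    then show "\<exists>y\<in>dom (diagonal_operator a). y \<in> l2.mball x r"
      using x N z by (intro bexI[of _ ?z]) (simp_all del: l2_simps)
  qed auto
  let ?image = "\<lambda>y z. z \<in> carrier l2 \<and>
    (\<forall>x\<in>dom (diagonal_operator a). cinner l2 (the (diagonal_operator a x)) y = cinner l2 x z)"
  have image_iff: "?image y z \<longleftrightarrow> y \<in> dom (diagonal_operator a) \<and> z = (\<lambda>n. of_real (a n) * y n)"
    if y: "y \<in> carrier l2" for y z
  proof
    assume z: "?image y z"
    have "z n = of_real (a n) * y n" for n
    proof -
      have "cinner l2 (the (diagonal_operator a (unit_sequence n))) y = cinner l2 (unit_sequence n) z"
        using z unit_sequence_in_dom_diagonal by blast
      then have "of_real (a n) * cnj (y n) = cnj (z n)"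
        unfolding diagonal_apply[OF unit_sequence_in_dom_diagonal] option.sel
        by (simp add: cinner_l2 unit_sequence_def suminf_single[of n])
      then have "cnj (of_real (a n) * cnj (y n)) = z n" by simp
      then show ?thesis by simp
    qed
    then have "z = (\<lambda>n. of_real (a n) * y n)" by blast
    then show "y \<in> dom (diagonal_operator a) \<and> z = (\<lambda>n. of_real (a n) * y n)"
      using y z unfolding dom_diagonal by blast
  next
    assume "y \<in> dom (diagonal_operator a) \<and> z = (\<lambda>n. of_real (a n) * y n)"
    then show "?image y z"
      unfolding dom_diagonal
      by (auto simp: diagonal_operator_def cinner_l2 mult_ac simp del: l2_simps)
  qed
  show "adjoint_operator l2 (diagonal_operator a) = diagonal_operator a"
  proof
    fix y
    show "adjoint_operator l2 (diagonal_operator a) y = diagonal_operator a y"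
    proof (cases "y \<in> dom (diagonal_operator a)")
      case True
      then have y: "y \<in> carrier l2" unfolding dom_diagonal by blast
      have image: "?image y (\<lambda>n. of_real (a n) * y n)"
        using image_iff[OF y] True by blast
      then have the_eq: "(THE z. ?image y z) = (\<lambda>n. of_real (a n) * y n)"
        using image_iff[OF y] by (intro the_equality) blast+
      have "y \<in> carrier l2 \<and> (\<exists>z. ?image y z)"
        using y image by blast
      then have "adjoint_operator l2 (diagonal_operator a) y = Some (THE z. ?image y z)"
        unfolding adjoint_operator_def Let_def by (rule if_P)
      then show ?thesis
        unfolding the_eq diagonal_apply[OF True] .
    next
      case False
      have "\<not> (y \<in> carrier l2 \<and> (\<exists>z. ?image y z))"
        using image_iff False by blast
      then have "adjoint_operator l2 (diagonal_operator a) y = None"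
        unfolding adjoint_operator_def Let_def by (rule if_not_P)
      also have "\<dots> = diagonal_operator a y"
        using False unfolding domIff by simp
      finally show ?thesis .
    qed
  qed
qed

lemma positive_diagonal:
  assumes "\<And>n. a n \<ge> 0"
  shows "positive_operator l2 (diagonal_operator a)"
  unfolding positive_operator_def
proof
  fix x assume x: "x \<in> dom (diagonal_operator a)"
  then have "summable (\<lambda>n. of_real (a n) * x n * cnj (x n))"
    unfolding dom_diagonal by (intro summable_cinner_l2) blast+
  moreover have eq: "of_real (a n) * x n * cnj (x n) = complex_of_real (a n * (cmod (x n))\<^sup>2)" for n
    unfolding of_real_mult complex_norm_square by (rule mult.assoc)
  ultimately have s: "summable (\<lambda>n. complex_of_real (a n * (cmod (x n))\<^sup>2))"
    by simp
  have "cinner l2 (the (diagonal_operator a x)) x = (\<Sum>n. complex_of_real (a n * (cmod (x n))\<^sup>2))"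
    unfolding diagonal_apply[OF x] option.sel cinner_l2 eq ..
  also have "\<dots> = of_real (\<Sum>n. a n * (cmod (x n))\<^sup>2)"
    using s by (subst suminf_of_real) (simp_all only: summable_of_real_iff)
  finally show "cinner l2 (the (diagonal_operator a x)) x \<in> \<real>\<^sub>\<ge>\<^sub>0"
    using s assms by (simp only: summable_of_real_iff nonneg_Reals_of_real_iff)
      (intro suminf_nonneg; simp)
qed

text \<open>
  Both sides say that \<open>x\<close> and \<open>y\<close> are square summable and that \<open>y = a x\<close>, equivalently \<open>x = y / a\<close>: the
  domain of the one operator is the range of the other. Injectivity and the inverse of a diagonal operator, with its natural domain, are read off from this symmetry.
\<close>

lemma diagonal_eq_Some_iff:
  assumes "\<And>n. a n \<noteq> 0"
  shows "diagonal_operator a x = Some y \<longleftrightarrow>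
    diagonal_operator (\<lambda>n. inverse (a n)) y = Some x"
proof -
  have "diagonal_operator b y = Some x"
    if "diagonal_operator a x = Some y" "\<And>n. a n * b n = 1" for a b and x y :: "nat \<Rightarrow> complex"
  proof -
    have xy: "x \<in> carrier l2" "y \<in> carrier l2" "y = (\<lambda>n. of_real (a n) * x n)"
      using that(1) by (auto simp: diagonal_operator_def split: if_splits)
    have "of_real (b n) * y n = x n" for n
    proof -
      have "of_real (b n) * y n = of_real (a n * b n) * x n"
        by (simp add: xy(3))
      then show ?thesis by (simp add: that(2))
    qed
    then have "(\<lambda>n. of_real (b n) * y n) = x" by blast
    then show ?thesis using xy(1,2) unfolding diagonal_operator_def by presburger
  qed
  from this[of a x y "\<lambda>n. inverse (a n)"] this[of "\<lambda>n. inverse (a n)" y x a]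
  show ?thesis using assms by auto
qed

lemma inj_on_diagonal:
  assumes "\<And>n. a n \<noteq> 0"
  shows "inj_on (diagonal_operator a) (dom (diagonal_operator a))"
  by (rule inj_onI) (metis assms diagonal_eq_Some_iff domD option.inject)

lemma inverse_diagonal:
  assumes "\<And>n. a n \<noteq> 0"
  shows "inverse_operator (diagonal_operator a) = diagonal_operator (\<lambda>n. inverse (a n))"
proof
  fix y
  show "inverse_operator (diagonal_operator a) y = diagonal_operator (\<lambda>n. inverse (a n)) y"
    using diagonal_eq_Some_iff[OF assms]
    by (cases "diagonal_operator (\<lambda>n. inverse (a n)) y")
      (simp_all add: inverse_operator_def ran_def)
qed

section \<open>Reflections\<close>

definition reflection :: "(nat \<Rightarrow> complex) \<Rightarrow> ((nat \<Rightarrow> complex) \<rightharpoonup> (nat \<Rightarrow> complex))" where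
  "reflection u = (\<lambda>x. if x \<in> carrier l2 then Some (\<lambda>n. x n - 2 * cinner l2 x u * u n) else None)"

lemma dom_reflection: "dom (reflection u) = carrier l2"
  by (auto simp: reflection_def dom_def)

lemma cinner_rank_one_left:
  assumes "x \<in> carrier l2" "u \<in> carrier l2" "y \<in> carrier l2"
  shows "cinner l2 (\<lambda>n. x n - c * u n) y = cinner l2 x y - c * cinner l2 u y"
  using l2.cinner_add_left[OF assms(1) l2_smult_closed[OF assms(2), of "-c"] assms(3)]
    l2.cinner_smult_left[OF assms(2,3), of "-c"]
  by simp

lemma cinner_rank_one_right:
  assumes "x \<in> carrier l2" "u \<in> carrier l2" "y \<in> carrier l2"
  shows "cinner l2 y (\<lambda>n. x n - c * u n) = cinner l2 y x - cnj c * cinner l2 y u"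
  using l2.cinner_add_right[OF assms(1) l2_smult_closed[OF assms(2), of "-c"] assms(3)]
    l2.cinner_smult_right[OF assms(2,3), of "-c"]
  by simp

context
  fixes u :: "nat \<Rightarrow> complex"
  assumes u: "u \<in> carrier l2" and unit: "cinner l2 u u = 1"
begin

lemma reflection_closed:
  assumes "x \<in> carrier l2"
  shows "the (reflection u x) \<in> carrier l2"
proof -
  have "(\<lambda>n. x n - 2 * cinner l2 x u * u n) \<in> carrier l2"
    by (rule l2_diff_closed[OF assms l2_smult_closed[OF u]])
  then show ?thesis using assms by (simp add: reflection_def)
qed

lemma reflection_symmetric:
  assumes "x \<in> carrier l2" "y \<in> carrier l2"
  shows "cinner l2 (the (reflection u x)) y = cinner l2 x (the (reflection u y))"
  using assms l2.cinner_commute[OF assms(2) u]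
  by (simp add: reflection_def cinner_rank_one_left cinner_rank_one_right u del: l2_simps)

lemma reflection_involution:
  assumes "x \<in> carrier l2"
  shows "the (reflection u (the (reflection u x))) = x"
proof -
  have "cinner l2 (\<lambda>n. x n - 2 * cinner l2 x u * u n) u = - cinner l2 x u"
    using cinner_rank_one_left[OF assms u u] unit by simp
  then show ?thesis
    using assms reflection_closed[OF assms] by (simp add: reflection_def del: l2_simps)
qed

text \<open>
  Being everywhere defined and symmetric, a reflection is its own adjoint; being also an involution,
  it is unitary.
\<close>

lemma adjoint_reflection: "adjoint_operator l2 (reflection u) = reflection u"
proof
  fix y
  let ?image = "\<lambda>z. z \<in> carrier l2 \<and>
    (\<forall>x\<in>dom (reflection u). cinner l2 (the (reflection u x)) y = cinner l2 x z)"
  show "adjoint_operator l2 (reflection u) y = reflection u y"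
  proof (cases "y \<in> carrier l2")
    case True
    have image: "?image (the (reflection u y))"
      using True reflection_closed reflection_symmetric by (simp add: dom_reflection del: l2_simps)
    have "z = the (reflection u y)" if z: "?image z" for z
    proof
      fix n
      have "cinner l2 (unit_sequence n) z = cinner l2 (unit_sequence n) (the (reflection u y))"
        using z image unit_sequence_in_l2[of n] unfolding dom_reflection by (metis (no_types))
      then show "z n = the (reflection u y) n"
        by (simp add: cinner_l2 unit_sequence_def suminf_single[of n])
    qed
    then have the_eq: "(THE z. ?image z) = the (reflection u y)"
      using image by (intro the_equality) blast+
    have "y \<in> carrier l2 \<and> (\<exists>z. ?image z)"
      using True image by blast
    then have "adjoint_operator l2 (reflection u) y = Some (THE z. ?image z)"
      unfolding adjoint_operator_def Let_def by (rule if_P)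
    also have "\<dots> = reflection u y"
      unfolding the_eq using True by (simp add: reflection_def del: l2_simps)
    finally show ?thesis .
  next
    case False
    then show ?thesis by (simp add: adjoint_operator_def Let_def reflection_def del: l2_simps)
  qed
qed

lemma unitary_reflection: "unitary_operator l2 (reflection u)"
  unfolding unitary_operator_def adjoint_reflection
proof (intro conjI dom_reflection)
  show "linear_operator l2 (reflection u)"
    unfolding linear_operator_def dom_reflection
  proof (intro conjI ballI allI)
    show "submodule (carrier l2) (ring_of_type_algebra :: complex ring) l2"
      by (rule l2.carrier_is_submodule)
    show "ran (reflection u) \<subseteq> carrier l2"
      using reflection_closed by (force simp: ran_def reflection_def simp del: l2_simps split: if_splits)
    show "the (reflection u (x \<oplus>\<^bsub>l2\<^esub> y)) = the (reflection u x) \<oplus>\<^bsub>l2\<^esub> the (reflection u y)"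
      if "x \<in> carrier l2" "y \<in> carrier l2" for x y
      using that l2_add_closed[OF that] l2.cinner_add_left[OF that u]
      by (simp add: reflection_def algebra_simps)
    show "the (reflection u (c \<odot>\<^bsub>l2\<^esub> x)) = c \<odot>\<^bsub>l2\<^esub> the (reflection u x)"
      if "x \<in> carrier l2" for c x
      using that l2_smult_closed[OF that, of c] l2.cinner_smult_left[OF that u, of c]
      by (simp add: reflection_def algebra_simps)
  qed
  show "bounded_operator l2 (reflection u)"
    unfolding bounded_operator_def dom_reflection
  proof (intro exI[of _ 1] ballI)
    fix x assume x: "x \<in> carrier l2"
    have "cinner l2 (the (reflection u x)) (the (reflection u x)) = cinner l2 x x"
      using reflection_symmetric[OF x reflection_closed[OF x]] reflection_involution[OF x] by simp
    then show "hnorm l2 (the (reflection u x)) \<le> 1 * hnorm l2 x"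
      by (simp add: hnorm_def)
  qed
  have involution: "reflection u \<circ>\<^sub>m reflection u = id_operator l2"
  proof
    fix x
    show "(reflection u \<circ>\<^sub>m reflection u) x = id_operator l2 x"
    proof (cases "x \<in> carrier l2")
      case True
      have some: "reflection u y = Some (the (reflection u y))" if "y \<in> carrier l2" for y
        using that by (simp add: reflection_def del: l2_simps)
      have "(reflection u \<circ>\<^sub>m reflection u) x = reflection u (the (reflection u x))"
        by (subst map_comp_def, subst some[OF True]) simp
      then show ?thesis
        using some[OF reflection_closed[OF True]] reflection_involution[OF True] True
        by (simp add: id_operator_def del: l2_simps)
    next
      case False
      then show ?thesis
        by (simp add: id_operator_def map_comp_def reflection_def del: l2_simps)
    qed
  qed
  show "reflection u \<circ>\<^sub>m reflection u = id_operator l2"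
    and "reflection u \<circ>\<^sub>m reflection u = id_operator l2"
    by (rule involution)+
qed

section \<open>The conjugated reflection\<close>

text \<open>
  Dividing \<open>A x - 2 c u\<close> coordinatewise by the weights gives \<open>x - 2 c (u / a)\<close>. As \<open>x\<close> is square summable
  and \<open>u / a\<close> is not, the quotient is square summable only for \<open>c = 0\<close>, and then it is \<open>x\<close>.
\<close>

lemma conjugated_reflection:
  assumes a: "\<And>n. a n \<noteq> 0"
    and not_ran: "(\<lambda>n. of_real (inverse (a n)) * u n) \<notin> carrier l2"
  shows "inverse_operator (diagonal_operator a) \<circ>\<^sub>m reflection u \<circ>\<^sub>m diagonal_operator a
    = Some |` {x \<in> dom (diagonal_operator a). cinner l2 (\<lambda>n. of_real (a n) * x n) u = 0}"
    (is "?B = Some |` ?D")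
proof
  fix x
  show "?B x = (Some |` ?D) x"
  proof (cases "x \<in> dom (diagonal_operator a)")
    case True
    define y where "y = (\<lambda>n. of_real (a n) * x n)"
    define c where "c = cinner l2 y u"
    define w where "w = (\<lambda>n. y n - 2 * c * u n)"
    have x: "x \<in> carrier l2" and y: "y \<in> carrier l2"
      using True unfolding dom_diagonal y_def by blast+
    have w: "w \<in> carrier l2"
      unfolding w_def by (rule l2_diff_closed[OF y l2_smult_closed[OF u]])
    have Bx: "?B x = diagonal_operator (\<lambda>n. inverse (a n)) w"
      using y unfolding map_comp_def inverse_diagonal[OF a]
      by (simp add: diagonal_apply[OF True] reflection_def w_def c_def flip: y_def del: l2_simps)
    have w_quot: "(\<lambda>n. of_real (inverse (a n)) * w n)
        = (\<lambda>n. x n - 2 * c * (of_real (inverse (a n)) * u n))"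
      using a by (simp add: w_def y_def right_diff_distrib mult_ac)
    show ?thesis
    proof (cases "c = 0")
      case True
      then show ?thesis
        using Bx w w_quot x \<open>x \<in> dom _\<close>
        by (simp add: diagonal_operator_def[of "\<lambda>n. inverse (a n)"] c_def y_def del: l2_simps)
    next
      case False
      have "(\<lambda>n. of_real (inverse (a n)) * w n) \<notin> carrier l2"
      proof
        assume "(\<lambda>n. of_real (inverse (a n)) * w n) \<in> carrier l2"
        then have "(\<lambda>n. 1 / (2 * c) * (x n - of_real (inverse (a n)) * w n)) \<in> carrier l2"
          by (intro l2_smult_closed l2_diff_closed x)
        moreover have "(\<lambda>n. 1 / (2 * c) * (x n - of_real (inverse (a n)) * w n))
            = (\<lambda>n. of_real (inverse (a n)) * u n)"
          using False fun_cong[OF w_quot] by simp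
        ultimately show False using not_ran by metis
      qed
      then show ?thesis
        using Bx False
        by (simp add: diagonal_operator_def[of "\<lambda>n. inverse (a n)"] c_def y_def del: l2_simps)
    qed
  next
    case False
    then have "diagonal_operator a x = None" by (simp add: domIff)
    then show ?thesis using False by (simp add: map_comp_def)
  qed
qed

text \<open>
  A finitely supported \<open>z\<close> is moved into the kernel by subtracting a multiple of a unit sequence
  \<open>e\<^sub>m\<close>. Cancelling the value \<open>c\<close> of the functional at \<open>z\<close> takes a correction of norm
  \<open>\<bar>c\<bar> / (a\<^sub>m \<bar>u\<^sub>m\<bar>)\<close>, which is as small as desired because \<open>a\<^sub>m \<bar>u\<^sub>m\<bar>\<close> is unbounded.
\<close>

lemma dense_kernel:
  assumes unbounded: "\<And>K. \<exists>n. K < a n * cmod (u n)"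
  shows "htopology l2 closure_of
      {x \<in> dom (diagonal_operator a). cinner l2 (\<lambda>n. of_real (a n) * x n) u = 0} = carrier l2"
    (is "_ closure_of ?D = _")
  unfolding l2.metric_closure_of
proof (intro equalityI subsetI CollectI conjI allI impI)
  fix x and r :: real assume x: "x \<in> carrier l2" and r: "r > 0"
  obtain N where N: "hdist l2 x (\<lambda>n. if n < N then x n else 0) < r / 2"
    using finite_support_dense_l2[OF x, of "r / 2"] r by auto
  define z where "z = (\<lambda>n. if n < N then x n else 0)"
  define c where "c = cinner l2 (\<lambda>n. of_real (a n) * z n) u"
  obtain m where m: "2 * cmod c / r < a m * cmod (u m)"
    using unbounded by blast
  then have "0 < a m * cmod (u m)"
    using r by (smt (verit) divide_nonneg_pos norm_ge_zero)
  then have am: "a m > 0" "u m \<noteq> 0"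
    by (auto simp: zero_less_mult_iff)
  define d where "d = c / (of_real (a m) * cnj (u m))"
  define y where "y = (\<lambda>n. z n - d * unit_sequence m n)"
  have y_supp: "y n = 0" if "n \<ge> N + Suc m" for n
    using that by (simp add: y_def z_def unit_sequence_def)
  have z: "z \<in> carrier l2"
    by (rule finite_support_in_l2[of N]) (simp add: z_def)
  have az: "(\<lambda>n. of_real (a n) * z n) \<in> carrier l2"
    by (rule finite_support_in_l2[of N]) (simp add: z_def)
  have y: "y \<in> carrier l2"
    by (rule finite_support_in_l2[OF y_supp])
  have "cinner l2 (\<lambda>n. of_real (a n) * y n) u
      = cinner l2 (\<lambda>n. of_real (a n) * z n - (d * of_real (a m)) * unit_sequence m n) u"
    by (rule arg_cong[where f = "\<lambda>x. cinner l2 x u"])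
      (auto simp: y_def unit_sequence_def algebra_simps)
  also have "\<dots> = c - d * of_real (a m) * cinner l2 (unit_sequence m) u"
    using cinner_rank_one_left[OF az unit_sequence_in_l2 u] by (simp add: c_def)
  also have "cinner l2 (unit_sequence m) u = cnj (u m)"
    by (simp add: cinner_l2 unit_sequence_def suminf_single[of m])
  also have "c - d * of_real (a m) * cnj (u m) = 0"
    using am by (simp add: d_def)
  finally have yD: "y \<in> ?D"
    using finite_support_in_dom_diagonal[OF y_supp] by simp
  have "hdist l2 z y = cmod d"
  proof -
    have "(\<Sum>n. (cmod (z n - y n))\<^sup>2) = (\<Sum>n\<in>{m}. (cmod (z n - y n))\<^sup>2)"
      by (rule suminf_finite) (simp_all add: y_def unit_sequence_def)
    then show ?thesis
      unfolding hdist_l2[OF z y] by (simp add: y_def unit_sequence_def)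
  qed
  moreover have "cmod d < r / 2"
    using m am r by (simp add: d_def norm_divide norm_mult field_simps)
  ultimately have "hdist l2 x y < r"
    using l2.triangle[OF x z y] N by (simp add: z_def)
  then show "\<exists>y\<in>?D. y \<in> l2.mball x r"
    using x y yD by (intro bexI[of _ y]) (simp_all del: l2_simps)
qed auto

text \<open>
  Every element of the range of \<open>A\<close> restricted to the kernel is orthogonal to \<open>u\<close>, whereas the image
  \<open>p\<close> of a unit sequence is not. By Cauchy-Schwarz the distance from \<open>p\<close> to the orthogonal complement
  of \<open>u\<close> is at least \<open>\<bar>\<langle>p, u\<rangle>\<bar>\<close>, so the second coordinate alone keeps the point \<open>(e\<^sub>m, p)\<close> of the graph
  away from the graph of the restriction.
\<close>

lemma kernel_not_core:
  assumes m: "a m \<noteq> 0" "u m \<noteq> 0"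
  shows "\<not> is_core l2
    {x \<in> dom (diagonal_operator a). cinner l2 (\<lambda>n. of_real (a n) * x n) u = 0}
    (diagonal_operator a)" (is "\<not> is_core l2 ?D ?A")
proof
  assume core: "is_core l2 ?D ?A"
  define p where "p = (\<lambda>n. complex_of_real (a n) * unit_sequence m n)"
  have p: "p \<in> carrier l2"
    using unit_sequence_in_dom_diagonal[of m a] unfolding dom_diagonal p_def by blast
  have "(unit_sequence m, p) \<in> Map.graph ?A"
    unfolding p_def by (intro in_graphI diagonal_apply unit_sequence_in_dom_diagonal)
  then have cl: "(unit_sequence m, p)
      \<in> prod_topology (htopology l2) (htopology l2) closure_of Map.graph (?A |` ?D)"
    using core by (simp add: is_core_def)
  have pu: "cinner l2 p u = of_real (a m) * cnj (u m)"
    by (simp add: p_def cinner_l2 unit_sequence_def suminf_single[of m])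
  define r where "r = cmod (cinner l2 p u)"
  have r: "r > 0"
    using m by (simp add: r_def pu)
  have op: "openin (prod_topology (htopology l2) (htopology l2)) (carrier l2 \<times> l2.mball p r)"
    using openin_topspace[of "htopology l2"]
    by (simp add: openin_prod_Times_iff l2.openin_mball)
  have mem: "(unit_sequence m, p) \<in> carrier l2 \<times> l2.mball p r"
    using unit_sequence_in_l2 p r by (simp del: l2_simps)
  obtain q where "q \<in> Map.graph (?A |` ?D)" "q \<in> carrier l2 \<times> l2.mball p r"
    using cl[unfolded in_closure_of, THEN conjunct2, rule_format, OF conjI[OF mem op]] by blast
  then obtain x y where xy: "(x, y) \<in> Map.graph (?A |` ?D)" "y \<in> l2.mball p r"
    by (cases q) blast
  then have "x \<in> ?D" "?A x = Some y"
    by (auto simp: graph_def restrict_map_def split: if_splits)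
  then have y0: "cinner l2 y u = 0"
    using diagonal_apply[of x a] by auto
  have y: "y \<in> carrier l2" and dist: "hdist l2 p y < r"
    using xy(2) by auto
  have "cinner l2 (\<lambda>n. p n - y n) u = cinner l2 p u"
    using cinner_rank_one_left[OF p y u, of 1] y0 by simp
  moreover have "hnorm l2 u = 1"
    by (simp add: hnorm_def unit)
  ultimately have "r \<le> hdist l2 p y"
    using l2.cmod_cinner_le[OF l2_diff_closed[OF p y] u] p y l2_minus[OF p y]
    by (simp add: r_def hdist_def del: l2_simps)
  then show False using dist by simp
qed

end

section \<open>The weights and the unit vector\<close>

theorem proposition2p4:
  shows "\<exists>(H :: (nat \<Rightarrow> complex) inner_product_module) A v.
    hilbert_space H \<and>
    selfadjoint_operator H A \<and> positive_operator H A \<and> inj_on A (dom A) \<and>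
    unitary_operator H v \<and>
    densely_defined H (inverse_operator A \<circ>\<^sub>m v \<circ>\<^sub>m A) \<and>
    bounded_operator H (inverse_operator A \<circ>\<^sub>m v \<circ>\<^sub>m A) \<and>
    \<not> is_core H (dom (inverse_operator A \<circ>\<^sub>m v \<circ>\<^sub>m A)) A"
proof -
  define a :: "nat \<Rightarrow> real" where "a = (\<lambda>n. if even n then 4 ^ n else inverse (4 ^ n))"
  \<comment> \<open>The factor \<open>sqrt 3 / 2\<close> normalises, as the powers of \<open>1 / 4\<close> sum to \<open>4 / 3\<close>.\<close>
  define u :: "nat \<Rightarrow> complex" where "u = (\<lambda>n. of_real (sqrt 3 / 2 * (1 / 2) ^ n))"
  have a_pos: "a n > 0" for n
    by (simp add: a_def)
  then have a_nz: "a n \<noteq> 0" and a_nonneg: "a n \<ge> 0" for n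
    by (metis less_irrefl, simp add: less_imp_le)
  have cmod_u: "cmod (u n) = sqrt 3 / 2 * (1 / 2) ^ n" for n
    unfolding u_def norm_of_real by simp
  have geometric: "(\<lambda>n. 3 / 4 * (1 / 4 :: real) ^ n) sums (3 / 4 * (1 / (1 - 1 / 4)))"
    by (intro sums_mult geometric_sums) simp
  have square: "(cmod (u n))\<^sup>2 = 3 / 4 * (1 / 4) ^ n" for n
  proof -
    have "((1 / 2 :: real) ^ n)\<^sup>2 = (1 / 4) ^ n"
      by (simp add: power2_eq_square flip: power_mult_distrib)
    then show ?thesis
      unfolding cmod_u by (simp add: power_mult_distrib power_divide)
  qed
  have u_sums: "(\<lambda>n. (cmod (u n))\<^sup>2) sums 1"
    unfolding square using geometric by simp
  then have u: "u \<in> carrier l2"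
    by (simp add: sums_iff)
  have unit: "cinner l2 u u = 1"
    using u_sums unfolding cinner_l2_self[OF u] by (simp add: sums_iff)
  have growth: "4 ^ n * cmod (u n) = sqrt 3 / 2 * 2 ^ n" for n
  proof -
    have "(4 :: real) ^ n * (1 / 2) ^ n = 2 ^ n"
      by (simp flip: power_mult_distrib)
    then show ?thesis by (simp add: cmod_u)
  qed
  have sqrt3: "sqrt 3 \<ge> 1"
    by simp
  have unbounded: "\<exists>n. K < a n * cmod (u n)" for K
  proof -
    obtain k where k: "2 * K < 2 ^ k"
      using real_arch_pow[of 2 "2 * K"] by auto
    have "(2 :: real) ^ k \<le> 2 ^ (2 * k)"
      by (rule power_increasing) simp_all
    also have "\<dots> \<le> sqrt 3 * 2 ^ (2 * k)"
      using mult_right_mono[OF sqrt3, of "2 ^ (2 * k)"] by simp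
    finally have "K < a (2 * k) * cmod (u (2 * k))"
      using k growth[of "2 * k"] by (simp add: a_def)
    then show ?thesis ..
  qed
  have not_ran: "(\<lambda>n. of_real (inverse (a n)) * u n) \<notin> carrier l2"
  proof
    assume "(\<lambda>n. of_real (inverse (a n)) * u n) \<in> carrier l2"
    then have "(\<lambda>n. (cmod (of_real (inverse (a n)) * u n))\<^sup>2) \<longlonglongrightarrow> 0"
      unfolding l2_simps by (rule summable_LIMSEQ_zero)
    then have "\<forall>\<^sub>F n in sequentially. (cmod (of_real (inverse (a n)) * u n))\<^sup>2 < 1 / 4"
      by (rule order_tendstoD) simp
    then obtain N where N: "\<And>n. n \<ge> N \<Longrightarrow> (cmod (of_real (inverse (a n)) * u n))\<^sup>2 < 1 / 4"
      unfolding eventually_sequentially by blast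
    define n where "n = 2 * N + 1"
    have "odd n"
      by (simp add: n_def)
    then have "inverse (a n) = 4 ^ n"
      by (simp add: a_def)
    then have "cmod (of_real (inverse (a n)) * u n) = 4 ^ n * cmod (u n)"
      unfolding norm_mult norm_of_real by simp
    also have "\<dots> \<ge> 1 / 2"
      unfolding growth using mult_mono[OF sqrt3 one_le_power[of "2 :: real" n]] by simp
    finally have "(1 / 2)\<^sup>2 \<le> (cmod (of_real (inverse (a n)) * u n))\<^sup>2"
      by (intro power_mono) simp_all
    then show False
      using N[of n] by (simp add: n_def power2_eq_square)
  qed
  let ?A = "diagonal_operator a" and ?v = "reflection u"
  let ?D = "{x \<in> dom ?A. cinner l2 (\<lambda>n. of_real (a n) * x n) u = 0}"
  have conj: "inverse_operator ?A \<circ>\<^sub>m ?v \<circ>\<^sub>m ?A = Some |` ?D"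
    by (rule conjugated_reflection[OF u unit a_nz not_ran])
  have dom: "dom (Some |` ?D) = ?D"
    by (auto simp: restrict_map_def dom_def)
  show ?thesis
  proof (rule exI[of _ l2], rule exI[of _ ?A], rule exI[of _ ?v], unfold conj, intro conjI)
    show "hilbert_space l2"
      by (rule hilbert_space_l2)
    show "selfadjoint_operator l2 ?A"
      by (rule selfadjoint_diagonal)
    show "positive_operator l2 ?A"
      by (rule positive_diagonal[OF a_nonneg])
    show "inj_on ?A (dom ?A)"
      by (rule inj_on_diagonal[OF a_nz])
    show "unitary_operator l2 ?v"
      by (rule unitary_reflection[OF u unit])
    show "densely_defined l2 (Some |` ?D)"
      unfolding densely_defined_def dom by (rule dense_kernel[OF u unit unbounded])
    show "bounded_operator l2 (Some |` ?D)"
      unfolding bounded_operator_def dom by (intro exI[of _ 1]) simp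
    show "\<not> is_core l2 (dom (Some |` ?D)) ?A"
      unfolding dom
    proof (rule kernel_not_core[OF u unit a_nz])
      show "u 0 \<noteq> 0" by (simp add: u_def)
    qed
  qed
qed

end
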